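(* Let $\mathcal{A}:\mathbb{R}^{H\times W\times C}\to\mathbb{R}^{H\times W\times D}$ be the convolution operator with kernel $\mathbf{A}$, let $\mathcal{A}^*:\mathbb{R}^{H\times W\times D}\to\mathbb{R}^{H\times W\times C}$ be its adjoint transposed convolution operator, and let $\mathcal{E}:=\mathbf{I}-\mathcal{A}^*\circ\mathcal{A}$ be the reconstruction operator on $\mathbb{R}^{H\times W\times C}$. Let $\epsilon>0$ and $\beta\in\mathbb{R}$. For $\bm{x}\in\mathbb{R}^{H\times W\times C}$ put $$\bm{w}=\bm{w}(\bm{x})=\frac{1}{2(|\mathcal{E}(\bm{x})|+\epsilon)}$$ (entrywise), and define the operators from $\mathbb{R}^{H\times W\times C}$ to itself $$\mathcal{P}_{\text{vanilla}}(\bm{x})=\mathcal{E}(\bm{x}),\qquad \mathcal{P}_{\text{robust}}(\bm{x})=\bm{w}(\bm{x})\odot\mathcal{E}(\bm{x}),\qquad \mathcal{P}_{\text{elastic}}(\bm{x})=\bigl(\beta\mathbf{1}+(1-\beta)\bm{w}(\bm{x})\bigr)\odot\mathcal{E}(\bm{x}).$$ For an operator $\mathcal{P}$ on $\mathbb{R}^{H\times W\times C}$, a point $\bm{y}$ and a contamination $\Delta\in\mathbb{R}^{H\times W\times C}$, define the influence function $$IF(\Delta;\mathcal{P},\bm{y})=\lim_{t\to0^+}\frac{\mathcal{P}(t\Delta+(1-t)\bm{y})-\mathcal{P}(\bm{y})}{t}.$$ Then for all $\bm{x},\Delta\in\mathbb{R}^{H\times W\times C}$, with $\bm{w}=\bm{w}(\bm{x})$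 and $\bm{w}^2$ the entrywise square, $$IF(\Delta;\mathcal{P}_{\text{vanilla}},\bm{x})=\mathcal{E}(\Delta-\bm{x}),$$ $$IF(\Delta;\mathcal{P}_{\text{robust}},\bm{x})=2\epsilon\,\bm{w}^2\odot\mathcal{E}(\Delta-\bm{x}),$$ $$IF(\Delta;\mathcal{P}_{\text{elastic}},\bm{x})=\bigl(\beta\mathbf{1}+2(1-\beta)\epsilon\,\bm{w}^2\bigr)\odot\mathcal{E}(\Delta-\bm{x}).$$
   Context: $H,W,C,D$ are positive integers and $k=2k_0+1$ with $k_0\ge 0$ an integer. The kernel is $\mathbf{A}=(\bm{\alpha}_{dc})_{1\le d\le D,\,1\le c\le C}\in\mathbb{R}^{D\times C\times k\times k}$, each $\bm{\alpha}_{dc}\in\mathbb{R}^{k\times k}$ being indexed by $p,q\in\{-k_0,\dots,k_0\}$. For $\bm{\xi}\in\mathbb{R}^{H\times W}$ and $\bm{\alpha}\in\mathbb{R}^{k\times k}$, the convolution is $(\bm{\alpha}\star\bm{\xi})[i,j]=\sum_{p,q=-k_0}^{k_0}\bm{\xi}[i+p,j+q]\,\bm{\alpha}[p,q]$ and the transposed convolution is $(\bm{\alpha}*\bm{\xi})[i,j]=\sum_{p,q=-k_0}^{k_0}\bm{\xi}[i-p,j-q]\,\bm{\alpha}[p,q]$, where entries of $\bm{\xi}$ with index outside the range are taken to be $0$. For $\bm{x}=(\bm{\xi}_1,\dots,\bm{\xi}_C)\in\mathbb{R}^{H\times W\times C}$, $\mathcal{A}(\bm{x})=\sum_{c=1}^{C}(\bm{\alpha}_{1c}\star\bm{\xi}_c,\dots,\bm{\alpha}_{Dc}\star\bm{\xi}_c)$;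 for $\bm{z}=(\bm{\eta}_1,\dots,\bm{\eta}_D)\in\mathbb{R}^{H\times W\times D}$, $\mathcal{A}^*(\bm{z})=\sum_{d=1}^{D}(\bm{\alpha}_{d1}*\bm{\eta}_d,\dots,\bm{\alpha}_{dC}*\bm{\eta}_d)$. $\mathbf{I}$ is the identity operator, $\odot$ is the entrywise product, $|\cdot|$, reciprocals and addition of the scalar $\epsilon$ are taken entrywise, and $\mathbf{1}$ is the all-ones tensor. *)

theory Defs
  imports "HOL-Analysis.Analysis"
begin

text \<open>
  The spatial dimensions \<open>H\<close>, \<open>W\<close> and the numbers of channels \<open>C\<close>, \<open>D\<close> are the cardinalities of
  finite (hence nonempty) index types. The spatial index types are linearly ordered, so that
  their elements can be numbered \<open>1, \<dots>, H\<close> and \<open>1, \<dots>, W\<close>.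
\<close>

type_synonym ('h, 'w) image = "((real, 'w) vec, 'h) vec"

type_synonym ('h, 'w, 'c) tensor = "(('h, 'w) image, 'c) vec"

text \<open>
  A kernel is a family of \<open>k \<times> k\<close> filters with \<open>k = 2 * k0 + 1\<close>; only the values at
  \<open>p, q \<in> {-k0..k0}\<close> are ever used.
\<close>

type_synonym ('d, 'c) kernel = "'d \<Rightarrow> 'c \<Rightarrow> int \<Rightarrow> int \<Rightarrow> real"

text \<open>The position of an index, a bijection onto \<open>{1..CARD('n)}\<close>.\<close>

definition position :: "'n::{finite, linorder} \<Rightarrow> int"
  where "position i = int (card {..i})"

definition entry :: "('h::{finite, linorder}, 'w::{finite, linorder}) image \<Rightarrow> int \<Rightarrow> int \<Rightarrow> real"
  where "entry \<xi> a b =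
    (if a \<in> {1..int CARD('h)} \<and> b \<in> {1..int CARD('w)}
     then \<xi> $ (the_inv position a) $ (the_inv position b) else 0)"

definition conv2 :: "nat \<Rightarrow> (int \<Rightarrow> int \<Rightarrow> real) \<Rightarrow>
    ('h::{finite, linorder}, 'w::{finite, linorder}) image \<Rightarrow> ('h, 'w) image"
  where "conv2 k0 \<alpha> \<xi> = (\<chi> i j.
    \<Sum>p = - int k0..int k0. \<Sum>q = - int k0..int k0.
      entry \<xi> (position i + p) (position j + q) * \<alpha> p q)"

definition tconv2 :: "nat \<Rightarrow> (int \<Rightarrow> int \<Rightarrow> real) \<Rightarrow>
    ('h::{finite, linorder}, 'w::{finite, linorder}) image \<Rightarrow> ('h, 'w) image"
  where "tconv2 k0 \<alpha> \<xi> = (\<chi> i j.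
    \<Sum>p = - int k0..int k0. \<Sum>q = - int k0..int k0.
      entry \<xi> (position i - p) (position j - q) * \<alpha> p q)"

definition conv_op :: "nat \<Rightarrow> ('d::finite, 'c::finite) kernel \<Rightarrow>
    ('h::{finite, linorder}, 'w::{finite, linorder}, 'c) tensor \<Rightarrow> ('h, 'w, 'd) tensor"
  where "conv_op k0 A x = (\<Sum>c\<in>UNIV. \<chi> d. conv2 k0 (A d c) (x $ c))"

definition tconv_op :: "nat \<Rightarrow> ('d::finite, 'c::finite) kernel \<Rightarrow>
    ('h::{finite, linorder}, 'w::{finite, linorder}, 'd) tensor \<Rightarrow> ('h, 'w, 'c) tensor"
  where "tconv_op k0 A z = (\<Sum>d\<in>UNIV. \<chi> c. tconv2 k0 (A d c) (z $ d))"

definition recon_op :: "nat \<Rightarrow> ('d::finite, 'c::finite) kernel \<Rightarrow>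
    ('h::{finite, linorder}, 'w::{finite, linorder}, 'c) tensor \<Rightarrow> ('h, 'w, 'c) tensor"
  where "recon_op k0 A x = x - tconv_op k0 A (conv_op k0 A x)"

definition weight :: "nat \<Rightarrow> ('d::finite, 'c::finite) kernel \<Rightarrow> real \<Rightarrow>
    ('h::{finite, linorder}, 'w::{finite, linorder}, 'c) tensor \<Rightarrow> ('h, 'w, 'c) tensor"
  where "weight k0 A \<epsilon> x = (\<chi> c i j. 1 / (2 * (\<bar>recon_op k0 A x $ c $ i $ j\<bar> + \<epsilon>)))"

text \<open>
  On \<^type>\<open>vec\<close>, and hence on tensors, the library's \<open>*\<close> and powers are entrywise, and \<open>1\<close> is the
  all-ones tensor.
\<close>

definition P_vanilla :: "nat \<Rightarrow> ('d::finite, 'c::finite) kernel \<Rightarrow>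
    ('h::{finite, linorder}, 'w::{finite, linorder}, 'c) tensor \<Rightarrow> ('h, 'w, 'c) tensor"
  where "P_vanilla k0 A x = recon_op k0 A x"

definition P_robust :: "nat \<Rightarrow> ('d::finite, 'c::finite) kernel \<Rightarrow> real \<Rightarrow>
    ('h::{finite, linorder}, 'w::{finite, linorder}, 'c) tensor \<Rightarrow> ('h, 'w, 'c) tensor"
  where "P_robust k0 A \<epsilon> x = weight k0 A \<epsilon> x * recon_op k0 A x"

definition P_elastic :: "nat \<Rightarrow> ('d::finite, 'c::finite) kernel \<Rightarrow> real \<Rightarrow> real \<Rightarrow>
    ('h::{finite, linorder}, 'w::{finite, linorder}, 'c) tensor \<Rightarrow> ('h, 'w, 'c) tensor"
  where "P_elastic k0 A \<epsilon> \<beta> x =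
    (\<beta> *\<^sub>R 1 + (1 - \<beta>) *\<^sub>R weight k0 A \<epsilon> x) * recon_op k0 A x"

text \<open>
  \<^const>\<open>Lim\<close> is a total function, so existence of the limit is a separate claim.
\<close>

definition influence_quotient :: "'a::real_normed_vector \<Rightarrow> ('a \<Rightarrow> 'a) \<Rightarrow> 'a \<Rightarrow> real \<Rightarrow> 'a"
  where "influence_quotient \<Delta> P y t = (P (t *\<^sub>R \<Delta> + (1 - t) *\<^sub>R y) - P y) /\<^sub>R t"

definition has_influence_function :: "'a::real_normed_vector \<Rightarrow> ('a \<Rightarrow> 'a) \<Rightarrow> 'a \<Rightarrow> bool"
  where "has_influence_function \<Delta> P y \<longleftrightarrow> (\<exists>L. (influence_quotient \<Delta> P y \<longlongrightarrow> L) (at_right 0))"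

definition influence_function :: "'a::real_normed_vector \<Rightarrow> ('a \<Rightarrow> 'a) \<Rightarrow> 'a \<Rightarrow> 'a"
  where "influence_function \<Delta> P y = Lim (at_right 0) (influence_quotient \<Delta> P y)"

text \<open>The transposed convolution operator is the adjoint of the convolution operator.\<close>

lemma position_mono: "i < j \<Longrightarrow> position i < position j"
  unfolding position_def of_nat_less_iff by (rule psubset_card_mono) (auto simp: psubset_eq)

lemma position_inj: "inj position"
  by (metis injI linorder_less_linear order_less_irrefl position_mono)

lemma position_range: "range (position :: 'n::{finite, linorder} \<Rightarrow> int) = {1..int CARD('n)}"
proof (rule card_subset_eq)
  show "range (position :: 'n \<Rightarrow> int) \<subseteq> {1..int CARD('n)}"
  proof
    fix a assume "a \<in> range (position :: 'n \<Rightarrow> int)"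
    then obtain i :: 'n where a: "a = int (card {..i})" by (auto simp: position_def)
    have "card {..i} > 0" by (auto simp: card_gt_0_iff)
    moreover have "card {..i} \<le> CARD('n)" by (rule card_mono) auto
    ultimately show "a \<in> {1..int CARD('n)}" using a by auto
  qed
  show "card (range (position :: 'n \<Rightarrow> int)) = card {1..int CARD('n)}"
    by (simp add: card_image position_inj)
qed simp

lemma entry_position [simp]:
  fixes \<xi> :: "('h::{finite, linorder}, 'w::{finite, linorder}) image"
  shows "entry \<xi> (position i) (position j) = \<xi> $ i $ j"
proof -
  have "position i \<in> {1..int CARD('h)}" "position j \<in> {1..int CARD('w)}"
    unfolding position_range[symmetric] by (rule rangeI)+
  then show ?thesis
    unfolding entry_def by (simp only: the_inv_f_f position_inj simp_thms if_True)
qed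

lemma entry_eq_sum:
  fixes \<xi> :: "('h::{finite, linorder}, 'w::{finite, linorder}) image"
  shows "entry \<xi> a b =
    (\<Sum>i\<in>UNIV. \<Sum>j\<in>UNIV. if position i = a \<and> position j = b then \<xi> $ i $ j else 0)"
proof (cases "a \<in> range (position :: 'h \<Rightarrow> int) \<and> b \<in> range (position :: 'w \<Rightarrow> int)")
  case True
  then obtain i0 j0 where [simp]: "a = position (i0 :: 'h)" "b = position (j0 :: 'w)" by blast
  have "(if position i = a \<and> position j = b then \<xi> $ i $ j else 0) =
      (if i = i0 then if j = j0 then \<xi> $ i $ j else 0 else 0)" for i j
    by (auto simp: inj_eq[OF position_inj])
  then have "(\<Sum>i\<in>UNIV. \<Sum>j\<in>UNIV. if position i = a \<and> position j = b then \<xi> $ i $ j else 0)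
      = (\<Sum>i\<in>UNIV. if i = i0 then \<Sum>j\<in>UNIV. if j = j0 then \<xi> $ i $ j else 0 else 0)"
    by (intro sum.cong) auto
  also have "\<dots> = \<xi> $ i0 $ j0" by simp
  finally show ?thesis by simp
next
  case False
  then have "(\<Sum>i\<in>UNIV. \<Sum>j\<in>UNIV. if position i = a \<and> position j = b then \<xi> $ i $ j else 0) = 0"
    by (intro sum.neutral ballI) auto
  moreover have "entry \<xi> a b = 0"
    using False unfolding entry_def position_range by (simp only: if_False)
  ultimately show ?thesis by simp
qed

lemma inner_conv2:
  fixes \<xi> \<eta> :: "('h::{finite, linorder}, 'w::{finite, linorder}) image"
  shows "conv2 k0 \<alpha> \<xi> \<bullet> \<eta> = \<xi> \<bullet> tconv2 k0 \<alpha> \<eta>"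
proof -
  let ?K = "{- int k0..int k0}"
  let ?f = "\<lambda>p q i j i' j'. if position i' = position i + p \<and> position j' = position j + q
      then \<xi> $ i' $ j' * \<eta> $ i $ j * \<alpha> p q else 0"
  have L: "(\<Sum>p\<in>?K. \<Sum>q\<in>?K. entry \<xi> (position i + p) (position j + q) * \<alpha> p q) * \<eta> $ i $ j =
      (\<Sum>p\<in>?K. \<Sum>q\<in>?K. \<Sum>i'\<in>UNIV. \<Sum>j'\<in>UNIV. ?f p q i j i' j')" for i j
    unfolding entry_eq_sum sum_distrib_right by (intro sum.cong refl) auto
  have R: "\<xi> $ i' $ j' * (\<Sum>p\<in>?K. \<Sum>q\<in>?K. entry \<eta> (position i' - p) (position j' - q) * \<alpha> p q) =
      (\<Sum>p\<in>?K. \<Sum>q\<in>?K. \<Sum>i\<in>UNIV. \<Sum>j\<in>UNIV. ?f p q i j i' j')" for i' j'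
    unfolding entry_eq_sum sum_distrib_left sum_distrib_right
    by (intro sum.cong refl) auto
  define S where "S = (UNIV :: 'h set) \<times> (UNIV :: 'w set)"
  define g where "g p q u v = ?f p q (fst u) (snd u) (fst v) (snd v)" for p q u v
  have "conv2 k0 \<alpha> \<xi> \<bullet> \<eta> = (\<Sum>u\<in>S. \<Sum>r\<in>?K \<times> ?K. \<Sum>v\<in>S. g (fst r) (snd r) u v)"
    unfolding conv2_def inner_vec_def inner_real_def vec_lambda_beta L
      S_def g_def sum.cartesian_product' fst_conv snd_conv ..
  also have "\<dots> = (\<Sum>r\<in>?K \<times> ?K. \<Sum>u\<in>S. \<Sum>v\<in>S. g (fst r) (snd r) u v)"
    by (rule sum.swap)
  also have "\<dots> = (\<Sum>r\<in>?K \<times> ?K. \<Sum>v\<in>S. \<Sum>u\<in>S. g (fst r) (snd r) u v)"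
    by (intro sum.cong refl sum.swap)
  also have "\<dots> = (\<Sum>v\<in>S. \<Sum>r\<in>?K \<times> ?K. \<Sum>u\<in>S. g (fst r) (snd r) u v)"
    by (rule sum.swap)
  also have "\<dots> = \<xi> \<bullet> tconv2 k0 \<alpha> \<eta>"
    unfolding tconv2_def inner_vec_def inner_real_def vec_lambda_beta R
      S_def g_def sum.cartesian_product' fst_conv snd_conv ..
  finally show ?thesis .
qed

lemma inner_conv_op: "conv_op k0 A x \<bullet> z = x \<bullet> tconv_op k0 A z"
proof -
  have "conv_op k0 A x \<bullet> z = (\<Sum>d\<in>UNIV. \<Sum>c\<in>UNIV. conv2 k0 (A d c) (x $ c) \<bullet> z $ d)"
    by (simp add: conv_op_def inner_vec_def[of _ z] inner_sum_left)
  also have "\<dots> = (\<Sum>d\<in>UNIV. \<Sum>c\<in>UNIV. x $ c \<bullet> tconv2 k0 (A d c) (z $ d))"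
    unfolding inner_conv2 ..
  also have "\<dots> = x \<bullet> tconv_op k0 A z"
    by (simp add: tconv_op_def inner_vec_def[of x] inner_sum_right)
  finally show ?thesis .
qed

lemma tconv_op_eq_adjoint: "tconv_op k0 A = adjoint (conv_op k0 A)"
  by (rule adjoint_unique[symmetric]) (simp add: inner_conv_op)

end

theory Submission
  imports Defs
begin

text \<open>
  The reconstruction operator is linear, so along the contamination path it is affine in \<open>t\<close>, and
  all three operators apply a scalar function entrywise after it. The only non-obvious point is that
  \<open>s \<mapsto> s / (2 * (\<bar>s\<bar> + \<epsilon>))\<close> is differentiable even at \<open>s = 0\<close>, with derivative
  \<open>\<epsilon> / (2 * (\<bar>s\<bar> + \<epsilon>)\<^sup>2) = 2 * \<epsilon> * w\<^sup>2\<close>. The vanilla and the robust operators are the elastic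
  ones with \<open>\<beta> = 1\<close> and \<open>\<beta> = 0\<close>.
\<close>

text \<open>Testing \<open>f (x + y)\<close> and \<open>f (r *\<^sub>R x)\<close> against an
  arbitrary \<open>z\<close> moves \<open>f\<close> across the inner product, where linearity in the
  first argument applies. This avoids unfolding the convolution sums, and \<open>g\<close> need not
  be known to be linear.\<close>

lemma linear_if_adjoint:
  fixes f :: "'a::real_inner \<Rightarrow> 'b::real_inner"
  assumes "\<And>x z. f x \<bullet> z = x \<bullet> g z"
  shows "linear f"
  by (rule linearI; subst vector_eq_rdot[symmetric]) (simp_all add: assms inner_left_distrib)

lemma linear_recon_op: "linear (recon_op k0 A)"
proof -
  have conv: "linear (conv_op k0 A)"
    by (rule linear_if_adjoint[OF inner_conv_op])
  \<comment> \<open>The same adjoint identity, read backwards by symmetry of the inner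
    product.\<close>
  have tconv: "linear (tconv_op k0 A)"
    by (rule linear_if_adjoint[where g = "conv_op k0 A"]) (metis inner_conv_op inner_commute)
  show ?thesis
    unfolding recon_op_def
    using linear_compose_sub[OF linear_id linear_compose[OF conv tconv]] by (simp add: o_def id_def)
qed

lemma has_real_derivative_soft_sign:
  fixes \<epsilon> s :: real
  assumes "\<epsilon> > 0"
  shows "((\<lambda>s. s / (2 * (\<bar>s\<bar> + \<epsilon>))) has_real_derivative 2 * \<epsilon> * (1 / (2 * (\<bar>s\<bar> + \<epsilon>)))\<^sup>2) (at s)"
proof (cases "s = 0")
  case True
  \<comment> \<open>Since the function vanishes at 0, its difference quotient there is
    \<open>1 / (2 * (\<bar>h\<bar> + \<epsilon>))\<close> for nonzero \<open>h\<close>; the kink of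
    the absolute value is cancelled by the factor \<open>h\<close>.\<close>
  have "((\<lambda>h::real. 1 / (2 * (\<bar>h\<bar> + \<epsilon>))) \<longlongrightarrow> 1 / (2 * (\<bar>0\<bar> + \<epsilon>))) (at 0)"
    using assms by (intro tendsto_intros) auto
  then have "((\<lambda>h::real. h / (2 * (\<bar>h\<bar> + \<epsilon>)) / h) \<longlongrightarrow> 1 / (2 * (\<bar>0\<bar> + \<epsilon>))) (at 0)"
    by (rule Lim_transform_eventually) (simp add: eventually_at_filter)
  then show ?thesis
    using assms True by (simp add: DERIV_def power2_eq_square)
next
  case False
  have pos: "\<bar>s\<bar> + \<epsilon> > 0" using assms by linarith
  have "(abs has_real_derivative sgn s) (at s)"
    using has_derivative_norm[OF False] 
    by (simp add: has_field_derivative_def real_norm_def[abs_def] mult_commute_abs)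
  then have "((\<lambda>s. s / (2 * (\<bar>s\<bar> + \<epsilon>))) has_real_derivative
      (1 * (2 * (\<bar>s\<bar> + \<epsilon>)) - s * (2 * sgn s)) / (2 * (\<bar>s\<bar> + \<epsilon>) * (2 * (\<bar>s\<bar> + \<epsilon>)))) (at s)"
    using pos by (auto intro!: derivative_eq_intros)
  \<comment> \<open>The numerator of the quotient rule collapses because
    \<open>s * sgn s = \<bar>s\<bar>\<close>.\<close>
  also have "1 * (2 * (\<bar>s\<bar> + \<epsilon>)) - s * (2 * sgn s) = 2 * \<epsilon>"
    by (simp add: sgn_real_def)
  finally show ?thesis
    by (simp add: power2_eq_square)
qed

text \<open>Limits of tensors are entrywise, and each entry of the output depends only on the same
  entry of \<open>recon_op\<close>, so a one-variable chain rule suffices.\<close>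

lemma tendsto_influence_quotient_elastic:
  fixes A :: "('d::finite, 'c::finite) kernel"
    and x \<Delta> :: "('h::{finite, linorder}, 'w::{finite, linorder}, 'c) tensor"
  assumes "\<epsilon> > 0"
  shows "(influence_quotient \<Delta> (P_elastic k0 A \<epsilon> \<beta>) x \<longlongrightarrow>
    (\<beta> *\<^sub>R 1 + (2 * (1 - \<beta>) * \<epsilon>) *\<^sub>R (weight k0 A \<epsilon> x)\<^sup>2) * recon_op k0 A (\<Delta> - x)) (at_right 0)"
proof (intro vec_tendstoI)
  fix c i j
  define a where "a = recon_op k0 A x $ c $ i $ j"
  define v where "v = recon_op k0 A (\<Delta> - x) $ c $ i $ j"
  define g where "g s = s / (2 * (\<bar>s\<bar> + \<epsilon>))" for s
  \<comment> \<open>The derivative of \<open>g\<close> at \<open>a\<close>, which is also the entry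
    of \<open>2 * \<epsilon> * w\<^sup>2\<close>.\<close>
  define g' where "g' = 2 * \<epsilon> * (1 / (2 * (\<bar>a\<bar> + \<epsilon>)))\<^sup>2"
  have path: "recon_op k0 A (t *\<^sub>R \<Delta> + (1 - t) *\<^sub>R x) $ c $ i $ j = a + t * v" for t
  proof -
    have "t *\<^sub>R \<Delta> + (1 - t) *\<^sub>R x = x + t *\<^sub>R (\<Delta> - x)"
      by (simp add: algebra_simps)
    then show ?thesis
      by (simp add: a_def v_def linear_add[OF linear_recon_op] linear_scale[OF linear_recon_op])
  qed
  have P: "P_elastic k0 A \<epsilon> \<beta> y $ c $ i $ j =
      \<beta> * recon_op k0 A y $ c $ i $ j + (1 - \<beta>) * g (recon_op k0 A y $ c $ i $ j)" for y
    by (simp add: P_elastic_def weight_def g_def algebra_simps diff_divide_distrib)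
  \<comment> \<open>The point \<open>a\<close> is written as the value of the inner function at 0,
    as the chain rule expects.\<close>
  have "(g has_real_derivative g') (at (a + 0 * v))"
    unfolding g_def[abs_def] g'_def using has_real_derivative_soft_sign[OF assms, of a] by simp
  moreover have "((\<lambda>t. a + t * v) has_real_derivative v) (at 0)"
    by (auto intro!: derivative_eq_intros)
  ultimately have "((\<lambda>t. g (a + t * v)) has_real_derivative g' * v) (at 0)"
    by (rule DERIV_chain2)
  then have "((\<lambda>t. \<beta> * (a + t * v) + (1 - \<beta>) * g (a + t * v)) has_real_derivative
      (\<beta> + (1 - \<beta>) * g') * v) (at 0)"
    by (auto intro!: derivative_eq_intros simp: algebra_simps)
  \<comment> \<open>The derivative is a two-sided limit at 0; its right-hand half is the one in the
    influence function.\<close>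
  then have "((\<lambda>t. (\<beta> * (a + t * v) + (1 - \<beta>) * g (a + t * v) - (\<beta> * a + (1 - \<beta>) * g a)) / t)
      \<longlongrightarrow> (\<beta> + (1 - \<beta>) * g') * v) (at_right 0)"
    unfolding DERIV_def by (auto intro: filterlim_at_split[THEN iffD1, THEN conjunct2])
  moreover have "influence_quotient \<Delta> (P_elastic k0 A \<epsilon> \<beta>) x t $ c $ i $ j =
      (\<beta> * (a + t * v) + (1 - \<beta>) * g (a + t * v) - (\<beta> * a + (1 - \<beta>) * g a)) / t" for t
    by (simp add: influence_quotient_def P path divide_inverse flip: a_def)
  moreover have "((\<beta> *\<^sub>R 1 + (2 * (1 - \<beta>) * \<epsilon>) *\<^sub>R (weight k0 A \<epsilon> x)\<^sup>2)
      * recon_op k0 A (\<Delta> - x)) $ c $ i $ j = (\<beta> + (1 - \<beta>) * g') * v"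
    by (simp add: weight_def g'_def power2_eq_square flip: a_def v_def)
  ultimately show "((\<lambda>t. influence_quotient \<Delta> (P_elastic k0 A \<epsilon> \<beta>) x t $ c $ i $ j) \<longlongrightarrow>
      ((\<beta> *\<^sub>R 1 + (2 * (1 - \<beta>) * \<epsilon>) *\<^sub>R (weight k0 A \<epsilon> x)\<^sup>2)
        * recon_op k0 A (\<Delta> - x)) $ c $ i $ j) (at_right 0)"
    by simp
qed

text \<open>The filter \<open>at_right 0\<close> on the reals is nontrivial, so limits along it are
  unique and \<open>Lim\<close> must return \<open>L\<close>.\<close>

lemma influence_function_eqI:
  assumes "(influence_quotient \<Delta> P y \<longlongrightarrow> L) (at_right 0)"
  shows "has_influence_function \<Delta> P y \<and> influence_function \<Delta> P y = L"
  using assms tendsto_Lim[OF trivial_limit_at_right_real assms]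
  unfolding has_influence_function_def influence_function_def by blast

theorem theorem4p2:
  fixes k0 :: nat
    and A :: "('d::finite, 'c::finite) kernel"
    and \<epsilon> \<beta> :: real
    and x \<Delta> :: "('h::{finite, linorder}, 'w::{finite, linorder}, 'c) tensor"
  assumes "\<epsilon> > 0"
  shows "(has_influence_function \<Delta> (P_vanilla k0 A) x \<and>
      influence_function \<Delta> (P_vanilla k0 A) x = recon_op k0 A (\<Delta> - x)) \<and>
    (has_influence_function \<Delta> (P_robust k0 A \<epsilon>) x \<and>
      influence_function \<Delta> (P_robust k0 A \<epsilon>) x =
        ((2 * \<epsilon>) *\<^sub>R (weight k0 A \<epsilon> x)\<^sup>2) * recon_op k0 A (\<Delta> - x)) \<and>
    (has_influence_function \<Delta> (P_elastic k0 A \<epsilon> \<beta>) x \<and>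
      influence_function \<Delta> (P_elastic k0 A \<epsilon> \<beta>) x =
        (\<beta> *\<^sub>R 1 + (2 * (1 - \<beta>) * \<epsilon>) *\<^sub>R (weight k0 A \<epsilon> x)\<^sup>2)
          * recon_op k0 A (\<Delta> - x))"
proof (intro conjI[OF influence_function_eqI conjI[OF influence_function_eqI influence_function_eqI]])
  have "P_vanilla k0 A = (P_elastic k0 A \<epsilon> 1 :: ('h, 'w, 'c) tensor \<Rightarrow> _)"
    by (rule ext) (simp add: P_vanilla_def P_elastic_def)
  then show "(influence_quotient \<Delta> (P_vanilla k0 A) x \<longlongrightarrow> recon_op k0 A (\<Delta> - x)) (at_right 0)"
    using tendsto_influence_quotient_elastic[OF assms, of \<Delta> k0 A 1 x] by simp
  have "P_robust k0 A \<epsilon> = (P_elastic k0 A \<epsilon> 0 :: ('h, 'w, 'c) tensor \<Rightarrow> _)"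
    by (rule ext) (simp add: P_robust_def P_elastic_def)
  then show "(influence_quotient \<Delta> (P_robust k0 A \<epsilon>) x \<longlongrightarrow>
      ((2 * \<epsilon>) *\<^sub>R (weight k0 A \<epsilon> x)\<^sup>2) * recon_op k0 A (\<Delta> - x)) (at_right 0)"
    using tendsto_influence_quotient_elastic[OF assms, of \<Delta> k0 A 0 x] by simp
qed (rule tendsto_influence_quotient_elastic[OF assms])

end
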